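(* Let $\boldsymbol{X}_i$ be the $i$-th iterate of OPeRA run with $m$ one-bit measurements and initial point $\boldsymbol{X}_0$, let $\boldsymbol{X}^{\star}$ be the desired PSD matrix, and let $\omega_0=\|\boldsymbol{X}_0-\boldsymbol{X}^{\star}\|_{\mathrm F}^2$ be the initial squared error. Suppose that, for all $m\ge m^{\star}$, the recovery error satisfies $$\mathbb{E}\left\{\|\boldsymbol{X}_i-\boldsymbol{X}^{\star}\|_{\mathrm F}^2\right\}\ \le\ q^i\,\omega_0+\epsilon_0 e^{-\gamma_1 m},$$ where $q\in(0,1)$ and $\epsilon_0,\gamma_1>0$ are the constants described in the context, and let $\epsilon_1>q^i\omega_0$. Then, to recover the desired PSD matrix $\boldsymbol{X}^{\star}$ in one-bit phase retrieval by OPeRA in accordance with the criterion $$\mathbb{E}\left\{\|\boldsymbol{X}_i-\boldsymbol{X}^{\star}\|_{\mathrm F}^2\right\}\le\epsilon_1$$ with a probability of at least $1-\inf_{t\ge 0}\left\{M_Te^{-at}\right\}$, the number of measurements $m$ must obey $$m\ \ge\ \frac{1}{\gamma_1}\ln\left(\frac{\epsilon_0}{\epsilon_1-q^i\omega_0}\right),$$ where $i$ is the number of iterations.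
   Context: Setting (one-bit phase retrieval). An unknown signal $\mathbf{x}\in\mathbb{C}^n$ (or $\mathbb{R}^n$) is lifted to $\boldsymbol{X}^{\star}=\mathbf{x}\mathbf{x}^{\mathrm H}$. Given sensing vectors $\boldsymbol{a}_j$, set $\boldsymbol{V}_j=\boldsymbol{a}_j\boldsymbol{a}_j^{\mathrm H}$ and $y_j=|\boldsymbol{a}_j^{\mathrm H}\mathbf{x}|$, so that $y_j^2=\operatorname{Tr}(\boldsymbol{V}_j\boldsymbol{X}^{\star})$. One observes $r_j=\operatorname{sgn}(y_j-\tau_j)\in\{\pm1\}$ with thresholds $\tau_j\ge0$, $j\in\mathcal{J}=\{1,\dots,m\}$. The one-bit phase retrieval polyhedron is $\mathcal{P}=\{\boldsymbol{X}\mid r_j(\operatorname{Tr}(\boldsymbol{V}_j\boldsymbol{X})-\tau_j^2)\ge 0,\ j\in\mathcal{J}\}$. OPeRA (One-bit Phase Retrieval Algorithm) is the randomized Kaczmarz algorithm applied to this system. Write the system as $\boldsymbol{C}\mathbf{u}\le\boldsymbol{b}$ with $\mathbf{u}=\operatorname{vec}(\boldsymbol{X})$, rows $\boldsymbol{c}_j=-r_j\operatorname{vec}(\boldsymbol{V}_j^{\top})^{\top}$ and $b_j=-r_j\tau_j^2$. At each iteration an index $j$ is drawn independently with probability $\|\boldsymbol{c}_j\|_2^2/\|\boldsymbol{C}\|_{\mathrm F}^2$, and $\mathbf{u}_{i+1}=\mathbf{u}_i-\frac{(\boldsymbol{c}_j\mathbf{u}_i-b_j)^+}{\|\boldsymbol{c}_j\|_2^2}\boldsymbol{c}_j^{\mathrm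 H}$, where $(x)^+=\max\{x,0\}$ and $\mathbf{u}_i=\operatorname{vec}(\boldsymbol{X}_i)$. Standing convergence bound: $\mathbb{E}\{\|\boldsymbol{X}_i-\boldsymbol{X}^{\star}\|_{\mathrm F}^2\}\le q^i\|\boldsymbol{X}_0-\boldsymbol{X}^{\star}\|_{\mathrm F}^2+\Psi(m)$. Here $q\in(0,1)$ is a function of the condition number of $\boldsymbol{C}$, and $\Psi$ is a penalty function that is decreasing in the large-sample regime and approaches $0$ when the number of samples is enough to satisfy the PSD constraint. For $m\ge m^{\star}$ (the minimal measurement size) the tail $\Psi^{\star}(m)=\Psi(m)\mathbb{I}_{(m\ge m^{\star})}$, where $\mathbb{I}$ is the indicator function, is approximated by an exponential: $\epsilon_0,\gamma_1>0$ are determined by $\sup_m|\Psi^{\star}(m)-\epsilon_0e^{-\gamma_1m}|<\varepsilon$ for an arbitrarily small $\varepsilon>0$. The convergence bound is then used for $m\ge m^{\star}$ with $\Psi(m)$ replaced by $\epsilon_0e^{-\gamma_1 m}$. $M_T=\mathbb{E}\{e^{tT_{\mathrm{ave}}}\}$ is the moment generating function of $T_{\mathrm{ave}}=\frac1m\sum_{j=1}^m|\operatorname{Tr}(\boldsymbol{V}_j(\boldsymbol{X}_i-\boldsymbol{X}^{\star}))|$ (summands treated as i.i.d. random variables), and $a$ is the level in the Chernoff bound $\Pr(T_{\mathrm{ave}}\le a)\ge 1-\inf_{t\ge0}M_Te^{-at}$.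
   Formalization: "Must obey" is false literally (if X_0 = X*, the error is 0 for every m); proved instead: the assumed error bound is at most ε_1 iff m obeys the inequality, and for such m the criterion holds, jointly with T_ave ≤ a, with at least the stated probability. *)

theory Defs
  imports "HOL-Probability.Probability"
begin

text \<open>
  Signals and sensing vectors live in \<open>complex ^ 'n\<close>; measurements are indexed by \<open>{1..m}\<close>.
  The library norm on \<open>complex ^ 'n ^ 'n\<close> (vectors of vectors) is the Frobenius norm.
\<close>

definition herm_inner :: "complex ^ 'n \<Rightarrow> complex ^ 'n \<Rightarrow> complex"
  where "herm_inner v w = (\<Sum>k\<in>UNIV. cnj (v $ k) * w $ k)"

definition lift_mat :: "complex ^ 'n \<Rightarrow> complex ^ 'n ^ 'n"
  where "lift_mat v = (\<chi> k l. v $ k * cnj (v $ l))"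

text \<open>The sign takes values in \<open>{-1, 1}\<close> only, unlike the library's \<open>sgn\<close>; a tie counts as \<open>1\<close>.\<close>

definition one_bit :: "complex ^ 'n \<Rightarrow> complex ^ 'n \<Rightarrow> real \<Rightarrow> real"
  where "one_bit x v \<tau> = (if cmod (herm_inner v x) \<ge> \<tau> then 1 else - 1)"

text \<open>Vectorisation keeps row/column pairs as indices, so no ordering of the entries is fixed.\<close>

definition mat_vec :: "complex ^ 'n ^ 'n \<Rightarrow> complex ^ ('n \<times> 'n)"
  where "mat_vec X = (\<chi> p. X $ fst p $ snd p)"

definition vec_mat :: "complex ^ ('n \<times> 'n) \<Rightarrow> complex ^ 'n ^ 'n"
  where "vec_mat u = (\<chi> k l. u $ (k, l))"

text \<open>
  The system \<open>C u \<le> b\<close>, with rows \<open>c\<^sub>j\<close>, for sensing vectors \<open>a\<close>, thresholds \<open>\<tau>\<close> and signal \<open>x\<close>.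
\<close>

definition sys_row :: "(nat \<Rightarrow> complex ^ 'n) \<Rightarrow> (nat \<Rightarrow> real) \<Rightarrow> complex ^ 'n \<Rightarrow> nat
    \<Rightarrow> complex ^ ('n \<times> 'n)"
  where "sys_row a \<tau> x j =
    - (one_bit x (a j) (\<tau> j) *\<^sub>R mat_vec (transpose (lift_mat (a j))))"

definition sys_rhs :: "(nat \<Rightarrow> complex ^ 'n) \<Rightarrow> (nat \<Rightarrow> real) \<Rightarrow> complex ^ 'n \<Rightarrow> nat \<Rightarrow> real"
  where "sys_rhs a \<tau> x j = - one_bit x (a j) (\<tau> j) * (\<tau> j)\<^sup>2"

definition row_apply :: "complex ^ 'k \<Rightarrow> complex ^ 'k \<Rightarrow> complex"
  where "row_apply c u = (\<Sum>p\<in>UNIV. c $ p * u $ p)"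

definition sys_frob2 :: "nat \<Rightarrow> (nat \<Rightarrow> complex ^ 'n) \<Rightarrow> (nat \<Rightarrow> real) \<Rightarrow> complex ^ 'n \<Rightarrow> real"
  where "sys_frob2 m a \<tau> x = (\<Sum>j\<in>{1..m}. (norm (sys_row a \<tau> x j))\<^sup>2)"

text \<open>
  If all rows vanish, the selection probabilities are undefined; then index \<open>1\<close> is taken, and the
  update below, which divides by \<open>0\<close>, leaves the iterate unchanged.
\<close>

definition index_pmf :: "nat \<Rightarrow> (nat \<Rightarrow> complex ^ 'n) \<Rightarrow> (nat \<Rightarrow> real) \<Rightarrow> complex ^ 'n \<Rightarrow> nat pmf"
  where "index_pmf m a \<tau> x =
    (if sys_frob2 m a \<tau> x = 0 then return_pmf 1
     else embed_pmf (\<lambda>j. if j \<in> {1..m}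
            then (norm (sys_row a \<tau> x j))\<^sup>2 / sys_frob2 m a \<tau> x else 0))"

lemma pmf_index_pmf:
  assumes "sys_frob2 m a \<tau> x \<noteq> 0"
  shows "pmf (index_pmf m a \<tau> x) j =
    (if j \<in> {1..m} then (norm (sys_row a \<tau> x j))\<^sup>2 / sys_frob2 m a \<tau> x else 0)"
proof -
  let ?f = "\<lambda>j. if j \<in> {1..m} then (norm (sys_row a \<tau> x j))\<^sup>2 / sys_frob2 m a \<tau> x else 0"
  have nn: "0 \<le> sys_frob2 m a \<tau> x"
    unfolding sys_frob2_def by (intro sum_nonneg) auto
  have f0: "0 \<le> ?f j" for j using nn by auto
  have s1: "(\<Sum>j\<in>{1..m}. ?f j) = 1"
  proof -
    have "(\<Sum>j\<in>{1..m}. ?f j) =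
        (\<Sum>j\<in>{1..m}. (norm (sys_row a \<tau> x j))\<^sup>2) / sys_frob2 m a \<tau> x"
      unfolding sum_divide_distrib by (intro sum.cong) auto
    then show ?thesis using assms by (simp add: sys_frob2_def)
  qed
  have "(\<integral>\<^sup>+ j. ennreal (?f j) \<partial>count_space UNIV) = (\<Sum>j\<in>{1..m}. ennreal (?f j))"
    by (rule nn_integral_count_space'[where A = "{1..m}"]) auto
  also have "\<dots> = ennreal (\<Sum>j\<in>{1..m}. ?f j)"
    using f0 by (intro sum_ennreal)
  also have "\<dots> = 1" using s1 by simp
  finally have "pmf (embed_pmf ?f) j = ?f j"
    using f0 by (intro pmf_embed_pmf)
  then show ?thesis using assms by (simp add: index_pmf_def)
qed

text \<open>
  For Hermitian \<open>X\<close> the value \<open>row_apply (sys_row a \<tau> x j) (mat_vec X)\<close> is real, so \<open>Re\<close> loses nothing,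
  and the update keeps the iterate Hermitian; see the two lemmas after the definition.
\<close>

definition opera_step :: "(nat \<Rightarrow> complex ^ 'n) \<Rightarrow> (nat \<Rightarrow> real) \<Rightarrow> complex ^ 'n \<Rightarrow> nat
    \<Rightarrow> complex ^ 'n ^ 'n \<Rightarrow> complex ^ 'n ^ 'n"
  where "opera_step a \<tau> x j X =
    (let c = sys_row a \<tau> x j; u = mat_vec X in
      vec_mat (u - (max (Re (row_apply c u) - sys_rhs a \<tau> x j) 0 / (norm c)\<^sup>2)
                     *\<^sub>R (\<chi> p. cnj (c $ p))))"

lemma row_apply_sys_row:
  "row_apply (sys_row a \<tau> x j) (mat_vec X) =
    - (of_real (one_bit x (a j) (\<tau> j)) * trace (lift_mat (a j) ** X))"
proof -
  have "row_apply (sys_row a \<tau> x j) (mat_vec X) =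
      (\<Sum>k\<in>UNIV. \<Sum>l\<in>UNIV.
        - (of_real (one_bit x (a j) (\<tau> j)) * (lift_mat (a j) $ l $ k * X $ k $ l)))"
    unfolding row_apply_def UNIV_Times_UNIV[symmetric] sum.cartesian_product
    by (intro sum.cong)
       (auto simp: sys_row_def mat_vec_def transpose_def scaleR_conv_of_real[where 'a = complex])
  also have "\<dots> = - (of_real (one_bit x (a j) (\<tau> j)) *
      (\<Sum>k\<in>UNIV. \<Sum>l\<in>UNIV. lift_mat (a j) $ l $ k * X $ k $ l))"
    by (simp add: sum_negf sum_distrib_left)
  also have "(\<Sum>k\<in>UNIV. \<Sum>l\<in>UNIV. lift_mat (a j) $ l $ k * X $ k $ l) =
      trace (lift_mat (a j) ** X)"
    unfolding trace_def matrix_matrix_mult_def by (simp, rule sum.swap)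
  finally show ?thesis .
qed

lemma row_apply_real:
  assumes "\<And>k l. X $ l $ k = cnj (X $ k $ l)"
  shows "row_apply (sys_row a \<tau> x j) (mat_vec X) \<in> \<real>"
proof -
  have "cnj (trace (lift_mat (a j) ** X)) = (\<Sum>k\<in>UNIV. \<Sum>l\<in>UNIV. lift_mat (a j) $ l $ k * X $ k $ l)"
    unfolding trace_def matrix_matrix_mult_def
    by (auto simp: lift_mat_def assms[symmetric] mult_ac intro!: sum.cong)
  also have "\<dots> = trace (lift_mat (a j) ** X)"
    unfolding trace_def matrix_matrix_mult_def by (simp, rule sum.swap)
  finally have "trace (lift_mat (a j) ** X) \<in> \<real>"
    by (simp add: Reals_cnj_iff)
  then show ?thesis
    unfolding row_apply_sys_row by (intro Reals_minus Reals_mult) auto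
qed

lemma opera_step_hermitian:
  assumes "\<And>k l. X $ l $ k = cnj (X $ k $ l)"
  shows "opera_step a \<tau> x j X $ l $ k = cnj (opera_step a \<tau> x j X $ k $ l)"
  using assms[of k l]
  by (simp add: opera_step_def Let_def vec_mat_def mat_vec_def sys_row_def lift_mat_def
      transpose_def scaleR_conv_of_real[where 'a = complex] mult_ac)

text \<open>
  Law of the \<open>i\<close>-th iterate over the independent index draws, for fixed measurements. The
  expectation in the recovery error is taken over these draws.
\<close>

primrec opera_pmf :: "nat \<Rightarrow> (nat \<Rightarrow> complex ^ 'n) \<Rightarrow> (nat \<Rightarrow> real) \<Rightarrow> complex ^ 'n
    \<Rightarrow> complex ^ 'n ^ 'n \<Rightarrow> nat \<Rightarrow> (complex ^ 'n ^ 'n) pmf"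
  where
    "opera_pmf m a \<tau> x X0 0 = return_pmf X0"
  | "opera_pmf m a \<tau> x X0 (Suc i) =
      bind_pmf (opera_pmf m a \<tau> x X0 i)
        (\<lambda>X. map_pmf (\<lambda>j. opera_step a \<tau> x j X) (index_pmf m a \<tau> x))"

definition recovery_error :: "nat \<Rightarrow> (nat \<Rightarrow> complex ^ 'n) \<Rightarrow> (nat \<Rightarrow> real) \<Rightarrow> complex ^ 'n
    \<Rightarrow> complex ^ 'n ^ 'n \<Rightarrow> nat \<Rightarrow> real"
  where "recovery_error m a \<tau> x X0 i =
    measure_pmf.expectation (opera_pmf m a \<tau> x X0 i) (\<lambda>X. (norm (X - lift_mat x))\<^sup>2)"

definition T_ave :: "nat \<Rightarrow> (nat \<Rightarrow> complex ^ 'n) \<Rightarrow> complex ^ 'n \<Rightarrow> complex ^ 'n ^ 'n \<Rightarrow> real"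
  where "T_ave m a x X =
    (1 / real m) * (\<Sum>j\<in>{1..m}. cmod (trace (lift_mat (a j) ** (X - lift_mat x))))"

text \<open>
  Random measurements on \<open>M\<close>: \<open>a j \<omega>\<close> and \<open>\<tau> j \<omega>\<close> are the realisations at \<open>\<omega>\<close>, and fixed ones are
  constant in \<open>\<omega>\<close>. The joint law of \<open>\<omega>\<close> and the \<open>i\<close>-th iterate draws \<open>\<omega>\<close> from \<open>M\<close> and then runs
  the algorithm on the realised measurements.
\<close>

definition opera_law :: "'w measure \<Rightarrow> (nat \<Rightarrow> 'w \<Rightarrow> complex ^ 'n) \<Rightarrow> (nat \<Rightarrow> 'w \<Rightarrow> real)
    \<Rightarrow> complex ^ 'n \<Rightarrow> complex ^ 'n ^ 'n \<Rightarrow> nat \<Rightarrow> nat \<Rightarrow> ('w \<times> (complex ^ 'n ^ 'n)) measure"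
  where "opera_law M a \<tau> x X0 m i =
    M \<bind> (\<lambda>\<omega>. distr (measure_pmf (opera_pmf m (\<lambda>j. a j \<omega>) (\<lambda>j. \<tau> j \<omega>) x X0 i))
                  (M \<Otimes>\<^sub>M borel) (\<lambda>X. (\<omega>, X)))"

text \<open>Extended-valued, so that a divergent moment generating function is \<open>\<infinity>\<close>.\<close>

definition mgf_T_ave :: "'w measure \<Rightarrow> (nat \<Rightarrow> 'w \<Rightarrow> complex ^ 'n) \<Rightarrow> (nat \<Rightarrow> 'w \<Rightarrow> real)
    \<Rightarrow> complex ^ 'n \<Rightarrow> complex ^ 'n ^ 'n \<Rightarrow> nat \<Rightarrow> nat \<Rightarrow> real \<Rightarrow> ennreal"
  where "mgf_T_ave M a \<tau> x X0 m i t =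
    (\<integral>\<^sup>+ (\<omega>, X). ennreal (exp (t * T_ave m (\<lambda>j. a j \<omega>) x X)) \<partial>opera_law M a \<tau> x X0 m i)"

end

theory Submission
  imports Defs
begin

text \<open>
  The threshold on \<open>m\<close> is the solution of \<open>q ^ i * \<omega>0 + \<epsilon>0 * exp (- \<gamma>1 * m) \<le> \<epsilon>1\<close> for \<open>m\<close>, so above
  it the recovery criterion holds for almost all measurements. Hence the joint event has the same
  probability as \<open>T_ave \<le> level\<close> alone, and Chernoff's bound applies. The real work is measurability:
  the law of the iterate is a mixture, with weights and atoms depending measurably on the sensing
  vectors and thresholds, and thus a Markov kernel.
\<close>

section \<open>Measurable dependence of the algorithm on measurements and iterate\<close>

lemma borel_measurable_vec_nth [measurable (raw)]:
  fixes f :: "'a \<Rightarrow> 'b::euclidean_space ^ 'k"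
  assumes "f \<in> borel_measurable N"
  shows "(\<lambda>z. f z $ k) \<in> borel_measurable N"
  by (rule measurable_compose[OF assms borel_measurable_continuous_onI]) (intro continuous_intros)

lemma borel_measurable_cnj [measurable (raw)]:
  assumes "f \<in> borel_measurable N"
  shows "(\<lambda>z. cnj (f z)) \<in> borel_measurable N"
  by (rule measurable_compose[OF assms borel_measurable_continuous_onI]) (intro continuous_intros)

text \<open>In a Euclidean space measurability is tested on inner products with basis vectors. These
  are of the form \<open>axis k b\<close>, so each test involves only the component
  \<open>f z k\<close>.\<close>

lemma borel_measurable_vec_lambda [measurable (raw)]:
  fixes f :: "'a \<Rightarrow> 'k::finite \<Rightarrow> 'b::euclidean_space"
  assumes "\<And>k. (\<lambda>z. f z k) \<in> borel_measurable N"
  shows "(\<lambda>z. \<chi> k. f z k) \<in> borel_measurable N"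
  unfolding borel_measurable_euclidean_space[of "\<lambda>z. \<chi> k. f z k"]
  using assms by (auto simp: Basis_vec_def inner_axis)

lemma borel_measurable_lift_mat [measurable (raw)]:
  assumes [measurable]: "f \<in> borel_measurable N"
  shows "(\<lambda>z. lift_mat (f z)) \<in> borel_measurable N"
  unfolding lift_mat_def by measurable

lemma borel_measurable_one_bit [measurable (raw)]:
  assumes [measurable]: "f \<in> borel_measurable N" "t \<in> borel_measurable N"
  shows "(\<lambda>z. one_bit x (f z) (t z)) \<in> borel_measurable N"
  unfolding one_bit_def herm_inner_def by measurable

lemma borel_measurable_mat_vec [measurable (raw)]:
  assumes [measurable]: "f \<in> borel_measurable N"
  shows "(\<lambda>z. mat_vec (f z)) \<in> borel_measurable N"
  unfolding mat_vec_def by measurable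

lemma borel_measurable_vec_mat [measurable (raw)]:
  assumes [measurable]: "f \<in> borel_measurable N"
  shows "(\<lambda>z. vec_mat (f z)) \<in> borel_measurable N"
  unfolding vec_mat_def by measurable

context
  fixes N :: "'w measure" and a :: "nat \<Rightarrow> 'w \<Rightarrow> complex ^ 'n" and \<tau> :: "nat \<Rightarrow> 'w \<Rightarrow> real"
  assumes a [measurable]: "\<And>j. a j \<in> borel_measurable N"
    and \<tau> [measurable]: "\<And>j. \<tau> j \<in> borel_measurable N"
begin

lemma borel_measurable_sys_row [measurable]:
  "(\<lambda>z. sys_row (\<lambda>j. a j z) (\<lambda>j. \<tau> j z) x j) \<in> borel_measurable N"
  unfolding sys_row_def transpose_def by measurable

text \<open>Here \<open>N\<close> is arbitrary and \<open>X\<close> may vary with \<open>z\<close>,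
  so that \<open>N\<close> can later be the product of \<open>M\<close> with the space of iterates,
  on which measurements and current iterate are the two projections.\<close>

lemma borel_measurable_opera_step:
  assumes [measurable]: "X \<in> borel_measurable N"
  shows "(\<lambda>z. opera_step (\<lambda>j. a j z) (\<lambda>j. \<tau> j z) x j (X z)) \<in> borel_measurable N"
  unfolding opera_step_def Let_def row_apply_def sys_rhs_def by measurable

lemma borel_measurable_pmf_index_pmf:
  "(\<lambda>z. pmf (index_pmf m (\<lambda>j. a j z) (\<lambda>j. \<tau> j z) x) j) \<in> borel_measurable N"
proof -
  have "(\<lambda>z. pmf (index_pmf m (\<lambda>j. a j z) (\<lambda>j. \<tau> j z) x) j) =
    (\<lambda>z. if sys_frob2 m (\<lambda>j. a j z) (\<lambda>j. \<tau> j z) x = 0 then indicator {1} j else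
      if j \<in> {1..m} then (norm (sys_row (\<lambda>j. a j z) (\<lambda>j. \<tau> j z) x j))\<^sup>2
        / sys_frob2 m (\<lambda>j. a j z) (\<lambda>j. \<tau> j z) x else 0)"
    by (rule ext) (simp add: pmf_index_pmf, simp add: index_pmf_def indicator_def)
  moreover have [measurable]: "(\<lambda>z. sys_frob2 m (\<lambda>j. a j z) (\<lambda>j. \<tau> j z) x) \<in> borel_measurable N"
    unfolding sys_frob2_def by measurable
  ultimately show ?thesis by simp
qed

lemma borel_measurable_T_ave:
  assumes [measurable]: "X \<in> borel_measurable N"
  shows "(\<lambda>z. T_ave m (\<lambda>j. a j z) x (X z)) \<in> borel_measurable N"
  unfolding T_ave_def trace_def matrix_matrix_mult_def by measurable

end

text \<open>For \<open>m = 0\<close> the default index 1 would lie outside the empty range; this is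
  where the condition \<open>1 \<le> m\<close> of the kernel lemmas comes from.\<close>

lemma set_index_pmf:
  assumes "1 \<le> m"
  shows "set_pmf (index_pmf m a \<tau> x) \<subseteq> {1..m}"
proof (cases "sys_frob2 m a \<tau> x = 0")
  case True
  then show ?thesis using assms by (simp add: index_pmf_def)
next
  case False
  then show ?thesis by (auto simp: set_pmf_iff pmf_index_pmf split: if_splits)
qed

text \<open>Turns the random index into a finite sum with explicit weights, so that measurability in
  the measurements can be checked term by term.\<close>

lemma nn_integral_index_pmf:
  fixes g :: "nat \<Rightarrow> ennreal"
  assumes "1 \<le> m"
  shows "(\<integral>\<^sup>+ j. g j \<partial>measure_pmf (index_pmf m a \<tau> x)) =
    (\<Sum>j\<in>{1..m}. g j * ennreal (pmf (index_pmf m a \<tau> x) j))"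
  using set_index_pmf[OF assms, of a \<tau> x] by (intro nn_integral_measure_pmf_support) auto

section \<open>The law of the iterate as a Markov kernel\<close>

context
  fixes M :: "'w measure" and a :: "nat \<Rightarrow> 'w \<Rightarrow> complex ^ 'n" and \<tau> :: "nat \<Rightarrow> 'w \<Rightarrow> real"
    and m :: nat
  assumes a [measurable]: "\<And>j. a j \<in> borel_measurable M"
    and \<tau> [measurable]: "\<And>j. \<tau> j \<in> borel_measurable M"
    and m: "1 \<le> m"
begin

text \<open>The last iteration is absorbed into the test function, which is why the induction needs
  \<open>f\<close> arbitrary.\<close>

lemma borel_measurable_nn_integral_opera_pmf:
  fixes f :: "'w \<times> (complex ^ 'n ^ 'n) \<Rightarrow> ennreal"
  assumes "f \<in> borel_measurable (M \<Otimes>\<^sub>M borel)"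
  shows "(\<lambda>\<omega>. \<integral>\<^sup>+ X. f (\<omega>, X) \<partial>measure_pmf (opera_pmf m (\<lambda>j. a j \<omega>) (\<lambda>j. \<tau> j \<omega>) x X0 i))
    \<in> borel_measurable M"
  using assms
proof (induction i arbitrary: f)
  case 0
  note [measurable] = 0
  show ?case by (simp add: nn_integral_return)
next
  case (Suc i)
  note [measurable] = Suc.prems
  let ?step = "\<lambda>z j. opera_step (\<lambda>j. a j (fst z)) (\<lambda>j. \<tau> j (fst z)) x j (snd z)"
  let ?ind = "\<lambda>z. index_pmf m (\<lambda>j. a j (fst z)) (\<lambda>j. \<tau> j (fst z)) x"
  \<comment> \<open>The conditional expectation of \<open>f\<close> after one more step, given the
    outcome \<open>fst z\<close> and the current iterate \<open>snd z\<close>.\<close>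
  let ?g = "\<lambda>z. \<Sum>j\<in>{1..m}. f (fst z, ?step z j) * ennreal (pmf (?ind z) j)"
  have [measurable]: "(\<lambda>z. ?step z j) \<in> borel_measurable (M \<Otimes>\<^sub>M borel)"
    "(\<lambda>z. pmf (?ind z) j) \<in> borel_measurable (M \<Otimes>\<^sub>M (borel :: (complex ^ 'n ^ 'n) measure))" for j
    by (intro borel_measurable_opera_step borel_measurable_pmf_index_pmf; measurable)+
  have "?g \<in> borel_measurable (M \<Otimes>\<^sub>M borel)"
    by measurable
  from Suc.IH[OF this] show ?case
    by (simp add: nn_integral_index_pmf[OF m])
qed

lemma borel_measurable_recovery_error:
  "(\<lambda>\<omega>. recovery_error m (\<lambda>j. a j \<omega>) (\<lambda>j. \<tau> j \<omega>) x X0 i) \<in> borel_measurable M"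
proof -
  have "(\<lambda>(\<omega>, X). ennreal ((norm (X - lift_mat x))\<^sup>2)) \<in> borel_measurable (M \<Otimes>\<^sub>M borel)"
    by measurable
  from borel_measurable_nn_integral_opera_pmf[OF this]
  show ?thesis
    unfolding recovery_error_def by (subst integral_eq_nn_integral) auto
qed

text \<open>The mass that the kernel gives to a set is the integral of its indicator, an instance of
  the integrals treated above. This fact makes the general rules for \<open>bind\<close> applicable
  to \<open>opera_law\<close>.\<close>

lemma measurable_opera_kernel:
  "(\<lambda>\<omega>. distr (measure_pmf (opera_pmf m (\<lambda>j. a j \<omega>) (\<lambda>j. \<tau> j \<omega>) x X0 i)) (M \<Otimes>\<^sub>M borel) (Pair \<omega>))
    \<in> measurable M (subprob_algebra (M \<Otimes>\<^sub>M borel))"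
proof (rule measurable_subprob_algebra)
  fix \<omega> assume \<omega>: "\<omega> \<in> space M"
  let ?p = "measure_pmf (opera_pmf m (\<lambda>j. a j \<omega>) (\<lambda>j. \<tau> j \<omega>) x X0 i)"
  have "Pair \<omega> \<in> measurable ?p (M \<Otimes>\<^sub>M borel)"
    using \<omega> by (auto simp: space_pair_measure)
  then show "subprob_space (distr ?p (M \<Otimes>\<^sub>M borel) (Pair \<omega>))"
    by (intro prob_space_imp_subprob_space measure_pmf.prob_space_distr)
next
  fix A :: "('w \<times> (complex ^ 'n ^ 'n)) set" assume [measurable]: "A \<in> sets (M \<Otimes>\<^sub>M borel)"
  let ?p = "\<lambda>\<omega>. measure_pmf (opera_pmf m (\<lambda>j. a j \<omega>) (\<lambda>j. \<tau> j \<omega>) x X0 i)"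
  have "emeasure (distr (?p \<omega>) (M \<Otimes>\<^sub>M borel) (Pair \<omega>)) A = (\<integral>\<^sup>+ X. indicator A (\<omega>, X) \<partial>?p \<omega>)"
    if "\<omega> \<in> space M" for \<omega>
  proof -
    have "Pair \<omega> \<in> measurable (?p \<omega>) (M \<Otimes>\<^sub>M borel)"
      using that by (auto simp: space_pair_measure)
    then have "(\<integral>\<^sup>+ z. indicator A z \<partial>distr (?p \<omega>) (M \<Otimes>\<^sub>M borel) (Pair \<omega>)) =
        (\<integral>\<^sup>+ X. indicator A (\<omega>, X) \<partial>?p \<omega>)"
      by (rule nn_integral_distr) measurable
    then show ?thesis by simp
  qed
  moreover have "(\<lambda>\<omega>. \<integral>\<^sup>+ X. indicator A (\<omega>, X) \<partial>?p \<omega>) \<in> borel_measurable M"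
    by (rule borel_measurable_nn_integral_opera_pmf) measurable
  ultimately show "(\<lambda>\<omega>. emeasure (distr (?p \<omega>) (M \<Otimes>\<^sub>M borel) (Pair \<omega>)) A) \<in> borel_measurable M"
    by (simp cong: measurable_cong)
qed simp

text \<open>Over an empty space \<open>bind\<close> defaults to a trivial measure, hence the
  assumption.\<close>

lemma sets_opera_law:
  assumes "space M \<noteq> {}"
  shows "sets (opera_law M a \<tau> x X0 m i) = sets (M \<Otimes>\<^sub>M borel)"
  unfolding opera_law_def using assms by (intro sets_bind) auto

lemma prob_space_opera_law:
  assumes "prob_space M"
  shows "prob_space (opera_law M a \<tau> x X0 m i)"
  unfolding opera_law_def
proof (rule prob_space.prob_space_bind[OF assms _ measurable_opera_kernel])
  show "AE \<omega> in M. prob_space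
      (distr (measure_pmf (opera_pmf m (\<lambda>j. a j \<omega>) (\<lambda>j. \<tau> j \<omega>) x X0 i)) (M \<Otimes>\<^sub>M borel) (Pair \<omega>))"
    by (intro AE_I2 measure_pmf.prob_space_distr) (auto simp: space_pair_measure)
qed

text \<open>The kernel at \<omega> is concentrated on pairs with first component \<omega>, so null
  sets of measurements stay null in the joint law.\<close>

lemma AE_opera_law_fst:
  assumes P: "AE \<omega> in M. P \<omega>" and [measurable]: "Measurable.pred M P"
  shows "AE z in opera_law M a \<tau> x X0 m i. P (fst z)"
proof -
  have "AE z in distr (measure_pmf (opera_pmf m (\<lambda>j. a j \<omega>) (\<lambda>j. \<tau> j \<omega>) x X0 i))
      (M \<Otimes>\<^sub>M borel) (Pair \<omega>). P (fst z)" if "\<omega> \<in> space M" "P \<omega>" for \<omega>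
  proof -
    have "Pair \<omega> \<in> measurable (measure_pmf (opera_pmf m (\<lambda>j. a j \<omega>) (\<lambda>j. \<tau> j \<omega>) x X0 i))
        (M \<Otimes>\<^sub>M borel)"
      using that by (auto simp: space_pair_measure)
    then show ?thesis
      using that(2) by (subst AE_distr_iff) auto
  qed
  then show ?thesis
    unfolding opera_law_def using P
    by (subst AE_bind[OF measurable_opera_kernel]) (auto elim!: AE_mp)
qed

end

text \<open>For each \<open>t\<close> the indicator of the upper tail lies below
  \<open>exp (t * (T z - c))\<close>. The extended setting also covers an infinite generating
  function.\<close>

lemma (in prob_space) chernoff_bound_Inf_nn_integral:
  assumes [measurable]: "T \<in> borel_measurable M"
  shows "1 - (INF t\<in>{0..}. (\<integral>\<^sup>+ z. ennreal (exp (t * T z)) \<partial>M) * ennreal (exp (- c * t)))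
    \<le> emeasure M {z \<in> space M. T z \<le> c}"
proof -
  let ?B = "{z \<in> space M. \<not> T z \<le> c}"
  have "emeasure M ?B \<le> (\<integral>\<^sup>+ z. ennreal (exp (t * T z)) \<partial>M) * ennreal (exp (- c * t))"
    if "0 \<le> t" for t
  proof -
    have "emeasure M ?B = (\<integral>\<^sup>+ z. indicator ?B z \<partial>M)"
      by simp
    also have "\<dots> \<le> (\<integral>\<^sup>+ z. ennreal (exp (t * T z)) * ennreal (exp (- c * t)) \<partial>M)"
    proof (rule nn_integral_mono)
      fix z
      have "0 \<le> t * T z + - c * t" if "c < T z"
        using \<open>0 \<le> t\<close> that mult_left_mono[of c "T z" t] by (simp add: mult.commute)
      then show "indicator ?B z \<le> ennreal (exp (t * T z)) * ennreal (exp (- c * t))"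
        by (auto simp: indicator_def ennreal_mult[symmetric] exp_add[symmetric]
            simp del: ennreal_1 simp flip: ennreal_1)
    qed
    finally show ?thesis by (simp add: nn_integral_multc)
  qed
  then have "emeasure M ?B
      \<le> (INF t\<in>{0..}. (\<integral>\<^sup>+ z. ennreal (exp (t * T z)) \<partial>M) * ennreal (exp (- c * t)))"
    by (intro INF_greatest) auto
  then have "1 - (INF t\<in>{0..}. (\<integral>\<^sup>+ z. ennreal (exp (t * T z)) \<partial>M) * ennreal (exp (- c * t)))
      \<le> 1 - emeasure M ?B"
    \<comment> \<open>Subtraction is truncated at 0, so an infimum above 1 merely makes the bound
      trivial.\<close>
    by (rule ennreal_minus_mono[OF order_refl])
  also have "\<dots> = emeasure M (space M - ?B)"
    by (subst emeasure_compl) (auto simp: emeasure_space_1)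
  also have "space M - ?B = {z \<in> space M. T z \<le> c}"
    by auto
  finally show ?thesis .
qed

text \<open>Positivity of \<open>d - b\<close> and \<open>e\<close> permits dividing and taking
  logarithms; positivity of \<open>g\<close> keeps the direction when solving for
  \<open>y\<close>.\<close>

lemma exp_tail_le_iff:
  fixes b e g d y :: real
  assumes "0 < e" "0 < g" "b < d"
  shows "b + e * exp (- g * y) \<le> d \<longleftrightarrow> 1 / g * ln (e / (d - b)) \<le> y"
proof -
  have "b + e * exp (- g * y) \<le> d \<longleftrightarrow> e / (d - b) \<le> exp (g * y)"
    using assms by (simp add: exp_minus field_simps)
  also have "\<dots> \<longleftrightarrow> ln (e / (d - b)) \<le> g * y"
    using assms by (subst ln_le_cancel_iff[symmetric]) auto
  also have "\<dots> \<longleftrightarrow> 1 / g * ln (e / (d - b)) \<le> y"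
    using assms by (simp add: field_simps)
  finally show ?thesis .
qed

text \<open>The requirement on \<open>m\<close> is an equivalence for the upper bound on the error,
  since the error itself is only bounded from above. The probability refers to the joint law,
  because the error still depends on the measurements and \<open>T_ave\<close> on the iterate as
  well.\<close>

theorem theorem2:
  fixes M :: "'w measure"
    and a :: "nat \<Rightarrow> 'w \<Rightarrow> complex ^ 'n"
    and \<tau> :: "nat \<Rightarrow> 'w \<Rightarrow> real"
    and x :: "complex ^ 'n"
    and X0 :: "complex ^ 'n ^ 'n"
    and m_star i :: nat
    and q \<epsilon>0 \<epsilon>1 \<gamma>1 level \<omega>0 :: real
  defines "\<omega>0 \<equiv> (norm (X0 - lift_mat x))\<^sup>2"
  assumes "prob_space M"
    and "\<And>j. a j \<in> borel_measurable M"
    and "\<And>j. \<tau> j \<in> borel_measurable M"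
    and "\<And>j \<omega>. \<omega> \<in> space M \<Longrightarrow> 0 \<le> \<tau> j \<omega>"
    and "0 < q" and "q < 1"
    and "0 < \<epsilon>0" and "0 < \<gamma>1"
    and "1 \<le> m_star"
    and "\<And>m. m_star \<le> m \<Longrightarrow>
          AE \<omega> in M. recovery_error m (\<lambda>j. a j \<omega>) (\<lambda>j. \<tau> j \<omega>) x X0 i
            \<le> q ^ i * \<omega>0 + \<epsilon>0 * exp (- \<gamma>1 * real m)"
    and "q ^ i * \<omega>0 < \<epsilon>1"
  shows "\<forall>m\<ge>m_star.
    (q ^ i * \<omega>0 + \<epsilon>0 * exp (- \<gamma>1 * real m) \<le> \<epsilon>1
      \<longleftrightarrow> 1 / \<gamma>1 * ln (\<epsilon>0 / (\<epsilon>1 - q ^ i * \<omega>0)) \<le> real m) \<and>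
    (1 / \<gamma>1 * ln (\<epsilon>0 / (\<epsilon>1 - q ^ i * \<omega>0)) \<le> real m \<longrightarrow>
      1 - (INF t\<in>{0..}. mgf_T_ave M a \<tau> x X0 m i t * ennreal (exp (- level * t)))
        \<le> emeasure (opera_law M a \<tau> x X0 m i)
            {(\<omega>, X) \<in> space (opera_law M a \<tau> x X0 m i).
              T_ave m (\<lambda>j. a j \<omega>) x X \<le> level \<and>
              recovery_error m (\<lambda>j. a j \<omega>) (\<lambda>j. \<tau> j \<omega>) x X0 i \<le> \<epsilon>1})"
proof (intro allI impI conjI)
  fix m assume m: "m_star \<le> m"
  show iff: "q ^ i * \<omega>0 + \<epsilon>0 * exp (- \<gamma>1 * real m) \<le> \<epsilon>1
      \<longleftrightarrow> 1 / \<gamma>1 * ln (\<epsilon>0 / (\<epsilon>1 - q ^ i * \<omega>0)) \<le> real m"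
    using assms by (intro exp_tail_le_iff) auto
  assume "1 / \<gamma>1 * ln (\<epsilon>0 / (\<epsilon>1 - q ^ i * \<omega>0)) \<le> real m"
  with iff have le: "q ^ i * \<omega>0 + \<epsilon>0 * exp (- \<gamma>1 * real m) \<le> \<epsilon>1" by simp
  have m1: "1 \<le> m" using m \<open>1 \<le> m_star\<close> by simp
  note [measurable] = assms(3,4)
  let ?L = "opera_law M a \<tau> x X0 m i"
  let ?R = "\<lambda>\<omega>. recovery_error m (\<lambda>j. a j \<omega>) (\<lambda>j. \<tau> j \<omega>) x X0 i"
  let ?T = "\<lambda>z. T_ave m (\<lambda>j. a j (fst z)) x (snd z)"
  interpret L: prob_space ?L
    by (rule prob_space_opera_law) (use assms m1 in auto)
  have sets_L [measurable_cong]: "sets ?L = sets (M \<Otimes>\<^sub>M borel)"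
    using assms m1 prob_space.not_empty by (intro sets_opera_law) auto
  have R [measurable]: "?R \<in> borel_measurable M"
    using assms m1 by (intro borel_measurable_recovery_error) auto
  have T [measurable]: "?T \<in> borel_measurable ?L"
    unfolding measurable_cong_sets[OF sets_L refl] by (intro borel_measurable_T_ave) measurable
  have "AE \<omega> in M. ?R \<omega> \<le> \<epsilon>1"
    \<comment> \<open>\<open>assms(11)\<close> is the assumed error bound, the definition of
      \<open>\<omega>0\<close> counting as \<open>assms(1)\<close>.\<close>
    using assms(11)[OF m] by eventually_elim (use le in simp)
  then have AE: "AE z in ?L. ?R (fst z) \<le> \<epsilon>1"
    by (rule AE_opera_law_fst[OF assms(3,4) m1]) measurable
  have "1 - (INF t\<in>{0..}. mgf_T_ave M a \<tau> x X0 m i t * ennreal (exp (- level * t)))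
      \<le> emeasure ?L {z \<in> space ?L. ?T z \<le> level}"
    using L.chernoff_bound_Inf_nn_integral[OF T, of level]
    by (simp add: mgf_T_ave_def case_prod_beta')
  \<comment> \<open>Adjoining an almost sure condition leaves the measure unchanged.\<close>
  also have "\<dots> = emeasure ?L {z \<in> space ?L. ?T z \<le> level \<and> ?R (fst z) \<le> \<epsilon>1}"
    using AE by (intro emeasure_eq_AE) auto
  also have "{z \<in> space ?L. ?T z \<le> level \<and> ?R (fst z) \<le> \<epsilon>1} =
      {(\<omega>, X) \<in> space ?L. T_ave m (\<lambda>j. a j \<omega>) x X \<le> level \<and> ?R \<omega> \<le> \<epsilon>1}"
    by auto
  finally show "1 - (INF t\<in>{0..}. mgf_T_ave M a \<tau> x X0 m i t * ennreal (exp (- level * t)))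
      \<le> emeasure ?L {(\<omega>, X) \<in> space ?L. T_ave m (\<lambda>j. a j \<omega>) x X \<le> level \<and> ?R \<omega> \<le> \<epsilon>1}" .
qed

end
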